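(* Let $T$ be a complete first-order theory in a countable language with monster model $M$. Suppose that $p\in S_1(\emptyset)$ is non-isolated and that $D_1,D_2\subseteq M$ are $\bar e$-definable sets such that: (1) $\overline{SI}_p\cap(D_1\times D_2)\neq\emptyset$ and it is relatively $\bar e$-definable within $D_1\times D_2$ (i.e. $\overline{SI}_p\cap(D_1\times D_2)=E\cap(D_1\times D_2)$ for some $\bar e$-definable $E\subseteq M^2$); (2) for all $a\in D_1\cap p(M)$ there is $b\in D_2\cap p(M)$ such that $a\mapsto b$; (3) for all $b\in D_2\cap p(M)$ there is $a\in D_1\cap p(M)$ such that $b\to a$. Then there is an $\bar e$-definable quasi-order $\leq$ on $M$ such that for no $a\in D_1\cap p(M)$ is there an element $c\in D_1$ with $a\leq c$ and $c$ maximal in $D_1$ with respect to $\leq$. In particular, $T$ has the strict order property.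
   Context: Write $a\to b$ if there is an $L$-formula $\phi(x,y)$ with $\models\phi(a,b)$ and $\phi(a,y)\vdash\mathrm{tp}(b)$ (semi-isolation); $a\mapsto b$ means $a\to b$ and not $b\to a$. For $p\in S_1(\emptyset)$, $\overline{SI}_p=\{(a,b)\in p(M)^2: a\to b\text{ or } b\to a\}$. *)

theory Defs
  imports "HOL-Library.Countable_Set"
begin

unbundle cardinal_syntax

record ('f, 'r) language =
  Funs :: "'f set"
  Rels :: "'r set"
  fun_arity :: "'f \<Rightarrow> nat"
  rel_arity :: "'r \<Rightarrow> nat"

definition countable_language :: "('f, 'r) language \<Rightarrow> bool" where
  "countable_language L \<longleftrightarrow> countable (Funs L) \<and> countable (Rels L)"

text \<open>Variables are de Bruijn indices into a list of elements; \<open>Exists\<close> binds index 0.\<close>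

datatype 'f trm = Var nat | Fn 'f "'f trm list"

datatype ('f, 'r) form =
    Equal "'f trm" "'f trm"
  | Rel 'r "'f trm list"
  | Neg "('f, 'r) form"
  | Conj "('f, 'r) form" "('f, 'r) form"
  | Exists "('f, 'r) form"

fun is_term :: "('f, 'r) language \<Rightarrow> nat \<Rightarrow> 'f trm \<Rightarrow> bool" where
  "is_term L n (Var i) \<longleftrightarrow> i < n"
| "is_term L n (Fn f ts) \<longleftrightarrow>
     f \<in> Funs L \<and> length ts = fun_arity L f \<and> (\<forall>t\<in>set ts. is_term L n t)"

primrec is_formula :: "('f, 'r) language \<Rightarrow> nat \<Rightarrow> ('f, 'r) form \<Rightarrow> bool" where
  "is_formula L n (Equal s t) \<longleftrightarrow> is_term L n s \<and> is_term L n t"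
| "is_formula L n (Rel r ts) \<longleftrightarrow>
     r \<in> Rels L \<and> length ts = rel_arity L r \<and> (\<forall>t\<in>set ts. is_term L n t)"
| "is_formula L n (Neg \<phi>) \<longleftrightarrow> is_formula L n \<phi>"
| "is_formula L n (Conj \<phi> \<psi>) \<longleftrightarrow> is_formula L n \<phi> \<and> is_formula L n \<psi>"
| "is_formula L n (Exists \<phi>) \<longleftrightarrow> is_formula L (Suc n) \<phi>"

text \<open>\<open>formulas L n\<close> is the set of \<open>L\<close>-formulas with free variables among \<open>0, \<dots>, n - 1\<close>;
  \<open>formulas L 0\<close> is the set of sentences.\<close>

definition formulas :: "('f, 'r) language \<Rightarrow> nat \<Rightarrow> ('f, 'r) form set" where
  "formulas L n = {\<phi>. is_formula L n \<phi>}"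

record ('f, 'r, 'm) struct =
  univ :: "'m set"
  fun_interp :: "'f \<Rightarrow> 'm list \<Rightarrow> 'm"
  rel_interp :: "'r \<Rightarrow> 'm list \<Rightarrow> bool"

definition is_structure :: "('f, 'r) language \<Rightarrow> ('f, 'r, 'm) struct \<Rightarrow> bool" where
  "is_structure L M \<longleftrightarrow> univ M \<noteq> {} \<and>
     (\<forall>f\<in>Funs L. \<forall>xs. set xs \<subseteq> univ M \<and> length xs = fun_arity L f
        \<longrightarrow> fun_interp M f xs \<in> univ M)"

primrec eval :: "('f, 'r, 'm) struct \<Rightarrow> 'm list \<Rightarrow> 'f trm \<Rightarrow> 'm" where
  "eval M xs (Var i) = xs ! i"
| "eval M xs (Fn f ts) = fun_interp M f (map (eval M xs) ts)"

primrec sat :: "('f, 'r, 'm) struct \<Rightarrow> 'm list \<Rightarrow> ('f, 'r) form \<Rightarrow> bool" where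
  "sat M xs (Equal s t) \<longleftrightarrow> eval M xs s = eval M xs t"
| "sat M xs (Rel r ts) \<longleftrightarrow> rel_interp M r (map (eval M xs) ts)"
| "sat M xs (Neg \<phi>) \<longleftrightarrow> \<not> sat M xs \<phi>"
| "sat M xs (Conj \<phi> \<psi>) \<longleftrightarrow> sat M xs \<phi> \<and> sat M xs \<psi>"
| "sat M xs (Exists \<phi>) \<longleftrightarrow> (\<exists>a\<in>univ M. sat M (a # xs) \<phi>)"

definition is_model ::
    "('f, 'r) language \<Rightarrow> ('f, 'r) form set \<Rightarrow> ('f, 'r, 'm) struct \<Rightarrow> bool" where
  "is_model L T M \<longleftrightarrow> is_structure L M \<and> (\<forall>\<sigma>\<in>T. sat M [] \<sigma>)"

text \<open>Logical consequence. HOL cannot quantify over structures on all types. For a countable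
  language the models with universe a subset of \<open>nat\<close> (finite or infinite) suffice, by the
  downward Loewenheim-Skolem theorem.\<close>

definition entails :: "('f, 'r) language \<Rightarrow> ('f, 'r) form set \<Rightarrow> ('f, 'r) form \<Rightarrow> bool" where
  "entails L T \<sigma> \<longleftrightarrow> (\<forall>N :: ('f, 'r, nat) struct. is_model L T N \<longrightarrow> sat N [] \<sigma>)"

definition complete_theory :: "('f, 'r) language \<Rightarrow> ('f, 'r) form set \<Rightarrow> bool" where
  "complete_theory L T \<longleftrightarrow> T \<subseteq> formulas L 0 \<and>
     (\<exists>N :: ('f, 'r, nat) struct. is_model L T N) \<and>
     (\<forall>\<sigma>\<in>formulas L 0. entails L T \<sigma> \<or> entails L T (Neg \<sigma>))"

text \<open>A pair \<open>(\<phi>, as)\<close> stands for the formula \<open>\<phi>(x, as)\<close> with parameters \<open>as\<close>.\<close>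

definition param_formulas ::
    "('f, 'r) language \<Rightarrow> 'm set \<Rightarrow> (('f, 'r) form \<times> 'm list) set" where
  "param_formulas L A = {(\<phi>, as). set as \<subseteq> A \<and> \<phi> \<in> formulas L (Suc (length as))}"

definition saturated ::
    "('f, 'r) language \<Rightarrow> 'k rel \<Rightarrow> ('f, 'r, 'm) struct \<Rightarrow> bool" where
  "saturated L \<kappa> M \<longleftrightarrow>
     (\<forall>A \<subseteq> univ M. |A| <o \<kappa> \<longrightarrow>
       (\<forall>\<Sigma> \<subseteq> param_formulas L A.
          (\<forall>\<Sigma>\<^sub>0 \<subseteq> \<Sigma>. finite \<Sigma>\<^sub>0 \<longrightarrow> (\<exists>c\<in>univ M. \<forall>(\<phi>, as)\<in>\<Sigma>\<^sub>0. sat M (c # as) \<phi>)) \<longrightarrow>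
          (\<exists>c\<in>univ M. \<forall>(\<phi>, as)\<in>\<Sigma>. sat M (c # as) \<phi>)))"

definition elementary_map ::
    "('f, 'r) language \<Rightarrow> ('f, 'r, 'm) struct \<Rightarrow> 'm set \<Rightarrow> ('m \<Rightarrow> 'm) \<Rightarrow> bool" where
  "elementary_map L M A f \<longleftrightarrow> f ` A \<subseteq> univ M \<and>
     (\<forall>as. set as \<subseteq> A \<longrightarrow>
       (\<forall>\<phi>\<in>formulas L (length as). sat M as \<phi> \<longleftrightarrow> sat M (map f as) \<phi>))"

definition automorphism ::
    "('f, 'r) language \<Rightarrow> ('f, 'r, 'm) struct \<Rightarrow> ('m \<Rightarrow> 'm) \<Rightarrow> bool" where
  "automorphism L M g \<longleftrightarrow> bij_betw g (univ M) (univ M) \<and>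
     (\<forall>f\<in>Funs L. \<forall>xs. set xs \<subseteq> univ M \<and> length xs = fun_arity L f
        \<longrightarrow> g (fun_interp M f xs) = fun_interp M f (map g xs)) \<and>
     (\<forall>r\<in>Rels L. \<forall>xs. set xs \<subseteq> univ M \<and> length xs = rel_arity L r
        \<longrightarrow> rel_interp M r xs = rel_interp M r (map g xs))"

definition strongly_homogeneous ::
    "('f, 'r) language \<Rightarrow> 'k rel \<Rightarrow> ('f, 'r, 'm) struct \<Rightarrow> bool" where
  "strongly_homogeneous L \<kappa> M \<longleftrightarrow>
     (\<forall>A \<subseteq> univ M. |A| <o \<kappa> \<longrightarrow>
       (\<forall>f. elementary_map L M A f \<longrightarrow> (\<exists>g. automorphism L M g \<and> (\<forall>a\<in>A. g a = f a))))"

text \<open>A monster model of a theory in a countable language: saturated and strongly homogeneous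
  with respect to some uncountable cardinal \<open>\<kappa>\<close>. No further largeness of \<open>\<kappa>\<close> is required.\<close>

definition monster_model ::
    "('f, 'r) language \<Rightarrow> ('f, 'r) form set \<Rightarrow> 'k rel \<Rightarrow> ('f, 'r, 'm) struct \<Rightarrow> bool" where
  "monster_model L T \<kappa> M \<longleftrightarrow> is_model L T M \<and> Card_order \<kappa> \<and> natLeq <o \<kappa> \<and>
     saturated L \<kappa> M \<and> strongly_homogeneous L \<kappa> M"

text \<open>From here on \<open>M\<close> plays the role of the monster model: consistency with the complete
  theory is finite satisfiability in \<open>M\<close>, and \<open>\<turnstile>\<close> between formulas with parameters from \<open>M\<close>
  is inclusion of their solution sets in \<open>M\<close>.\<close>

definition tp :: "('f, 'r) language \<Rightarrow> ('f, 'r, 'm) struct \<Rightarrow> 'm \<Rightarrow> ('f, 'r) form set" where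
  "tp L M a = {\<phi> \<in> formulas L 1. sat M [a] \<phi>}"

definition complete_1types ::
    "('f, 'r) language \<Rightarrow> ('f, 'r, 'm) struct \<Rightarrow> ('f, 'r) form set set" where
  "complete_1types L M = {p. p \<subseteq> formulas L 1 \<and>
     (\<forall>p\<^sub>0 \<subseteq> p. finite p\<^sub>0 \<longrightarrow> (\<exists>a\<in>univ M. \<forall>\<phi>\<in>p\<^sub>0. sat M [a] \<phi>)) \<and>
     (\<forall>\<phi>\<in>formulas L 1. \<phi> \<in> p \<or> Neg \<phi> \<in> p)}"

definition isolated :: "('f, 'r, 'm) struct \<Rightarrow> ('f, 'r) form set \<Rightarrow> bool" where
  "isolated M p \<longleftrightarrow> (\<exists>\<phi>\<in>p. \<forall>\<psi>\<in>p. \<forall>a\<in>univ M. sat M [a] \<phi> \<longrightarrow> sat M [a] \<psi>)"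

definition realizations :: "('f, 'r, 'm) struct \<Rightarrow> ('f, 'r) form set \<Rightarrow> 'm set" where
  "realizations M p = {a \<in> univ M. \<forall>\<phi>\<in>p. sat M [a] \<phi>}"

definition semi_isolates ::
    "('f, 'r) language \<Rightarrow> ('f, 'r, 'm) struct \<Rightarrow> 'm \<Rightarrow> 'm \<Rightarrow> bool" where
  "semi_isolates L M a b \<longleftrightarrow>
     (\<exists>\<phi>\<in>formulas L 2. sat M [a, b] \<phi> \<and>
        (\<forall>\<psi>\<in>tp L M b. \<forall>c\<in>univ M. sat M [a, c] \<phi> \<longrightarrow> sat M [c] \<psi>))"

definition strictly_semi_isolates ::
    "('f, 'r) language \<Rightarrow> ('f, 'r, 'm) struct \<Rightarrow> 'm \<Rightarrow> 'm \<Rightarrow> bool" where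
  "strictly_semi_isolates L M a b \<longleftrightarrow> semi_isolates L M a b \<and> \<not> semi_isolates L M b a"

definition SI_bar ::
    "('f, 'r) language \<Rightarrow> ('f, 'r, 'm) struct \<Rightarrow> ('f, 'r) form set \<Rightarrow> ('m \<times> 'm) set" where
  "SI_bar L M p = {(a, b). a \<in> realizations M p \<and> b \<in> realizations M p \<and>
     (semi_isolates L M a b \<or> semi_isolates L M b a)}"

definition definable_set ::
    "('f, 'r) language \<Rightarrow> ('f, 'r, 'm) struct \<Rightarrow> 'm list \<Rightarrow> 'm set \<Rightarrow> bool" where
  "definable_set L M e D \<longleftrightarrow>
     (\<exists>\<phi>\<in>formulas L (1 + length e). D = {a \<in> univ M. sat M ([a] @ e) \<phi>})"

definition definable_rel ::
    "('f, 'r) language \<Rightarrow> ('f, 'r, 'm) struct \<Rightarrow> 'm list \<Rightarrow> ('m \<times> 'm) set \<Rightarrow> bool" where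
  "definable_rel L M e R \<longleftrightarrow>
     (\<exists>\<phi>\<in>formulas L (2 + length e).
        R = {(a, b). a \<in> univ M \<and> b \<in> univ M \<and> sat M ([a, b] @ e) \<phi>})"

definition maximal_in :: "'m rel \<Rightarrow> 'm set \<Rightarrow> 'm \<Rightarrow> bool" where
  "maximal_in R D c \<longleftrightarrow> c \<in> D \<and> \<not> (\<exists>d\<in>D. (c, d) \<in> R \<and> (d, c) \<notin> R)"

definition solutions ::
    "('f, 'r, 'm) struct \<Rightarrow> nat \<Rightarrow> ('f, 'r) form \<Rightarrow> 'm list \<Rightarrow> 'm list set" where
  "solutions M n \<phi> b = {xs. length xs = n \<and> set xs \<subseteq> univ M \<and> sat M (xs @ b) \<phi>}"

text \<open>The strict order property of the complete theory of a monster model \<open>M\<close>: some formula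
  \<open>\<phi>(x; y)\<close>, with \<open>x\<close> an \<open>n\<close>-tuple and \<open>y\<close> an \<open>m\<close>-tuple, has an infinite strictly increasing
  chain of instances in \<open>M\<close>.\<close>

definition strict_order_property ::
    "('f, 'r) language \<Rightarrow> ('f, 'r, 'm) struct \<Rightarrow> bool" where
  "strict_order_property L M \<longleftrightarrow>
     (\<exists>n m. \<exists>\<phi>\<in>formulas L (n + m). \<exists>b :: nat \<Rightarrow> 'm list.
        (\<forall>i. length (b i) = m \<and> set (b i) \<subseteq> univ M) \<and>
        (\<forall>i. solutions M n \<phi> (b i) \<subset> solutions M n \<phi> (b (Suc i))))"

end

theory Submission
  imports Defs
begin

text \<open>On realizations of \<open>p\<close>, semi-isolation is the union of the parameter-free definable relations
  under which \<open>p(M)\<close> is closed. By compactness a single such relation \<open>S\<close> satisfies: any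
  \<open>(a, b) \<in> D\<^sub>1 \<times> D\<^sub>2\<close> in \<open>SI_bar\<close> has \<open>S a b\<close> or \<open>S b a\<close>. For \<open>a \<in> D\<^sub>1 \<inter> p(M)\<close> let \<open>G a\<close> be the set
  of \<open>b \<in> D\<^sub>2\<close> with \<open>E a b\<close> and \<open>S a b\<close>: every element of \<open>G a\<close> is semi-isolated by \<open>a\<close>, and every
  \<open>b \<in> D\<^sub>2\<close> strictly semi-isolated by \<open>a\<close> is in \<open>G a\<close>. Hence \<open>G\<close> is antitone along strict
  semi-isolation, and it strictly decreases after two alternations \<open>a \<mapsto> b \<rightarrow> a' \<mapsto> b' \<rightarrow> a''\<close>.
  Reverse inclusion of the sets \<open>G a\<close> is the required quasi-order.\<close>

section \<open>Renaming of variables in terms and formulas\<close>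

primrec rename_trm :: "(nat \<Rightarrow> nat) \<Rightarrow> 'f trm \<Rightarrow> 'f trm" where
  "rename_trm f (Var i) = Var (f i)"
| "rename_trm f (Fn g ts) = Fn g (map (rename_trm f) ts)"

text \<open>Under \<open>Exists\<close> index 0 is the bound variable: it stays fixed, and the free
  indices are shifted by one on both sides. The map \<open>f\<close> need not be injective, so
  variables may also be identified.\<close>

primrec rename :: "(nat \<Rightarrow> nat) \<Rightarrow> ('f, 'r) form \<Rightarrow> ('f, 'r) form" where
  "rename f (Equal s t) = Equal (rename_trm f s) (rename_trm f t)"
| "rename f (Rel r ts) = Rel r (map (rename_trm f) ts)"
| "rename f (Neg \<phi>) = Neg (rename f \<phi>)"
| "rename f (Conj \<phi> \<psi>) = Conj (rename f \<phi>) (rename f \<psi>)"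
| "rename f (Exists \<phi>) = Exists (rename (case_nat 0 (\<lambda>i. Suc (f i))) \<phi>)"

lemma is_term_rename_trm:
  "is_term L m t \<Longrightarrow> (\<And>i. i < m \<Longrightarrow> f i < n) \<Longrightarrow> is_term L n (rename_trm f t)"
  by (induction t) auto

lemma is_formula_rename:
  "is_formula L m \<phi> \<Longrightarrow> (\<And>i. i < m \<Longrightarrow> f i < n) \<Longrightarrow> is_formula L n (rename f \<phi>)"
proof (induction \<phi> arbitrary: m n f)
  case (Exists \<phi>)
  show ?case
    using Exists.prems by (auto intro!: Exists.IH[of "Suc m"] split: nat.split)
qed (auto simp: is_term_rename_trm)

lemma eval_rename_trm:
  "is_term L m t \<Longrightarrow> (\<And>i. i < m \<Longrightarrow> xs ! f i = ys ! i) \<Longrightarrow>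
    eval M xs (rename_trm f t) = eval M ys t"
proof (induction t)
  case (Fn g ts)
  then have "map (eval M xs \<circ> rename_trm f) ts = map (eval M ys) ts"
    by auto
  then show ?case by (simp only: rename_trm.simps eval.simps map_map)
qed auto

text \<open>Agreement is required only at indices below \<open>m\<close>, so \<open>xs\<close> may
  carry further entries. A formula can thus be moved to a longer list, or past a block of
  parameters.\<close>

lemma sat_rename:
  "is_formula L m \<phi> \<Longrightarrow> (\<And>i. i < m \<Longrightarrow> xs ! f i = ys ! i) \<Longrightarrow>
    sat M xs (rename f \<phi>) \<longleftrightarrow> sat M ys \<phi>"
proof (induction \<phi> arbitrary: m f xs ys)
  case (Equal s t)
  then show ?case using eval_rename_trm[of L m _ xs f ys M] by simp
next
  case (Rel r ts)
  then have "map (eval M xs \<circ> rename_trm f) ts = map (eval M ys) ts"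
    using eval_rename_trm[of L m _ xs f ys M] by simp
  then show ?case by (simp only: rename.simps sat.simps map_map)
next
  case (Exists \<phi>)
  have "sat M (a # xs) (rename (case_nat 0 (\<lambda>i. Suc (f i))) \<phi>) \<longleftrightarrow> sat M (a # ys) \<phi>" for a
    using Exists.prems by (intro Exists.IH[of "Suc m"]) (auto split: nat.split simp: nth_Cons')
  then show ?case by simp
qed auto

section \<open>Closure properties of definability with parameters\<close>

text \<open>A semantic view of definability, so that later formulas are built by closure rules
  instead of explicit de Bruijn syntax. The parameters stand at the end of the list, which leaves
  the front free for the variable bound by \<open>Exists\<close>.\<close>

definition definable_pred ::
    "('f, 'r) language \<Rightarrow> ('f, 'r, 'm) struct \<Rightarrow> 'm list \<Rightarrow> nat \<Rightarrow> ('m list \<Rightarrow> bool) \<Rightarrow> bool" where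
  "definable_pred L M e n P \<longleftrightarrow>
     (\<exists>\<phi>\<in>formulas L (n + length e). \<forall>xs. length xs = n \<and> set xs \<subseteq> univ M \<longrightarrow>
        (sat M (xs @ e) \<phi> \<longleftrightarrow> P xs))"

lemma definable_pred_cong:
  assumes "definable_pred L M e n P"
    and "\<And>xs. length xs = n \<Longrightarrow> set xs \<subseteq> univ M \<Longrightarrow> P xs \<longleftrightarrow> Q xs"
  shows "definable_pred L M e n Q"
  using assms unfolding definable_pred_def by simp

lemma definable_pred_not:
  assumes "definable_pred L M e n P"
  shows "definable_pred L M e n (\<lambda>xs. \<not> P xs)"
proof -
  obtain \<phi> where "\<phi> \<in> formulas L (n + length e)"
    "\<forall>xs. length xs = n \<and> set xs \<subseteq> univ M \<longrightarrow> (sat M (xs @ e) \<phi> \<longleftrightarrow> P xs)"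
    using assms by (auto simp: definable_pred_def)
  then show ?thesis
    unfolding definable_pred_def by (intro bexI[of _ "Neg \<phi>"]) (auto simp: formulas_def)
qed

lemma definable_pred_conj:
  assumes "definable_pred L M e n P" "definable_pred L M e n Q"
  shows "definable_pred L M e n (\<lambda>xs. P xs \<and> Q xs)"
proof -
  obtain \<phi> \<psi> where "\<phi> \<in> formulas L (n + length e)" "\<psi> \<in> formulas L (n + length e)"
    "\<forall>xs. length xs = n \<and> set xs \<subseteq> univ M \<longrightarrow> (sat M (xs @ e) \<phi> \<longleftrightarrow> P xs)"
    "\<forall>xs. length xs = n \<and> set xs \<subseteq> univ M \<longrightarrow> (sat M (xs @ e) \<psi> \<longleftrightarrow> Q xs)"
    using assms by (auto simp: definable_pred_def)
  then show ?thesis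
    unfolding definable_pred_def by (intro bexI[of _ "Conj \<phi> \<psi>"]) (auto simp: formulas_def)
qed

lemma definable_pred_disj:
  assumes "definable_pred L M e n P" "definable_pred L M e n Q"
  shows "definable_pred L M e n (\<lambda>xs. P xs \<or> Q xs)"
  using definable_pred_not[OF definable_pred_conj[OF assms[THEN definable_pred_not]]] by simp

lemma definable_pred_imp:
  assumes "definable_pred L M e n P" "definable_pred L M e n Q"
  shows "definable_pred L M e n (\<lambda>xs. P xs \<longrightarrow> Q xs)"
  using definable_pred_disj[OF definable_pred_not[OF assms(1)] assms(2)] by simp

lemma definable_pred_ex:
  assumes "definable_pred L M e (Suc n) P"
  shows "definable_pred L M e n (\<lambda>xs. \<exists>a\<in>univ M. P (a # xs))"
proof -
  obtain \<phi> where \<phi>: "\<phi> \<in> formulas L (Suc n + length e)"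
    "\<forall>xs. length xs = Suc n \<and> set xs \<subseteq> univ M \<longrightarrow> (sat M (xs @ e) \<phi> \<longleftrightarrow> P xs)"
    using assms by (auto simp: definable_pred_def)
  then have "sat M (a # xs @ e) \<phi> \<longleftrightarrow> P (a # xs)"
    if "a \<in> univ M" "length xs = n" "set xs \<subseteq> univ M" for a xs
    using that \<phi>(2)[rule_format, of "a # xs"] by simp
  with \<phi>(1) show ?thesis
    unfolding definable_pred_def by (intro bexI[of _ "Exists \<phi>"]) (auto simp: formulas_def)
qed

lemma definable_pred_all:
  assumes "definable_pred L M e (Suc n) P"
  shows "definable_pred L M e n (\<lambda>xs. \<forall>a\<in>univ M. P (a # xs))"
  using definable_pred_not[OF definable_pred_ex[OF definable_pred_not[OF assms]]] by simp

lemma definable_pred_formula: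
  assumes "\<phi> \<in> formulas L m" "\<And>i. i < m \<Longrightarrow> f i < n"
  shows "definable_pred L M e n (\<lambda>xs. sat M (map (\<lambda>i. xs ! f i) [0..<m]) \<phi>)"
proof -
  have "sat M (xs @ e) (rename f \<phi>) \<longleftrightarrow> sat M (map (\<lambda>i. xs ! f i) [0..<m]) \<phi>"
    if "length xs = n" for xs
    using assms that by (intro sat_rename[of L m]) (auto simp: formulas_def nth_append)
  moreover have "rename f \<phi> \<in> formulas L (n + length e)"
    using assms is_formula_rename[of L m \<phi> f "n + length e"] by (force simp: formulas_def)
  ultimately show ?thesis
    unfolding definable_pred_def by blast
qed

lemma definable_pred_select:
  assumes "definable_pred L M e m P" "\<And>i. i < m \<Longrightarrow> f i < n"
  shows "definable_pred L M e n (\<lambda>xs. P (map (\<lambda>i. xs ! f i) [0..<m]))"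
proof -
  obtain \<phi> where \<phi>: "\<phi> \<in> formulas L (m + length e)"
    "\<forall>xs. length xs = m \<and> set xs \<subseteq> univ M \<longrightarrow> (sat M (xs @ e) \<phi> \<longleftrightarrow> P xs)"
    using assms(1) by (auto simp: definable_pred_def)
  \<comment> \<open>The parameters start at position \<open>m\<close> before the renaming and at
    position \<open>n\<close> after it, hence the shift in the second branch.\<close>
  let ?g = "\<lambda>i. if i < m then f i else n + (i - m)"
  have "sat M (xs @ e) (rename ?g \<phi>) \<longleftrightarrow> P (map (\<lambda>i. xs ! f i) [0..<m])"
    if xs: "length xs = n" "set xs \<subseteq> univ M" for xs
  proof -
    have "sat M (xs @ e) (rename ?g \<phi>) \<longleftrightarrow> sat M (map (\<lambda>i. xs ! f i) [0..<m] @ e) \<phi>"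
      using \<phi>(1) xs(1) assms(2)
      by (intro sat_rename[of L "m + length e"]) (auto simp: formulas_def nth_append)
    moreover have "set (map (\<lambda>i. xs ! f i) [0..<m]) \<subseteq> univ M"
      using xs assms(2) by (auto intro!: subsetD[OF xs(2)])
    ultimately show ?thesis
      using \<phi>(2) by simp
  qed
  moreover have "rename ?g \<phi> \<in> formulas L (n + length e)"
    using \<phi>(1) assms(2) is_formula_rename[of L "m + length e" \<phi> ?g "n + length e"]
    by (force simp: formulas_def)
  ultimately show ?thesis
    unfolding definable_pred_def by blast
qed

lemma upt_0_2: "[0..<2] = [0, 1]"
  by (simp add: upt_rec)

lemma length_2E:
  assumes "length xs = 2"
  obtains a b where "xs = [a, b]"
  using assms by (auto simp: numeral_2_eq_2 length_Suc_conv)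

lemma definable_pred_rel:
  assumes "definable_rel L M e R" "i < n" "j < n"
  shows "definable_pred L M e n (\<lambda>xs. (xs ! i, xs ! j) \<in> R)"
proof -
  obtain \<phi> where \<phi>: "\<phi> \<in> formulas L (2 + length e)"
    and R: "R = {(a, b). a \<in> univ M \<and> b \<in> univ M \<and> sat M ([a, b] @ e) \<phi>}"
    using assms(1) by (auto simp: definable_rel_def)
  have "definable_pred L M e 2 (\<lambda>xs. (xs ! 0, xs ! 1) \<in> R)"
    unfolding definable_pred_def R using \<phi> by (intro bexI[of _ \<phi>]) (auto elim!: length_2E)
  from definable_pred_select[OF this, of "\<lambda>k. if k = 0 then i else j" n] assms(2,3) show ?thesis
    by (simp add: upt_0_2)
qed

text \<open>Semi-isolation is witnessed without parameters, whereas the sets and \<open>E\<close>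
  are definable over \<open>e\<close>. This lemma lets both kinds occur in one formula.\<close>

lemma definable_pred_rel_empty_params:
  assumes "definable_rel L M [] R" "i < n" "j < n"
  shows "definable_pred L M e n (\<lambda>xs. (xs ! i, xs ! j) \<in> R)"
proof -
  obtain \<phi> where \<phi>: "\<phi> \<in> formulas L 2"
    and R: "R = {(a, b). a \<in> univ M \<and> b \<in> univ M \<and> sat M [a, b] \<phi>}"
    using assms(1) by (auto simp: definable_rel_def)
  have "definable_pred L M e n (\<lambda>xs. sat M [xs ! i, xs ! j] \<phi>)"
    using definable_pred_formula[OF \<phi>, of "\<lambda>k. if k = 0 then i else j" n M e] assms(2,3)
    by (simp add: upt_0_2)
  moreover have "sat M [xs ! i, xs ! j] \<phi> \<longleftrightarrow> (xs ! i, xs ! j) \<in> R"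
    if "length xs = n" "set xs \<subseteq> univ M" for xs
    using that assms(2,3) by (auto simp: R intro!: subsetD[OF that(2)])
  ultimately show ?thesis
    by (rule definable_pred_cong)
qed

lemma definable_pred_set:
  assumes "definable_set L M e D" "i < n"
  shows "definable_pred L M e n (\<lambda>xs. xs ! i \<in> D)"
proof -
  obtain \<phi> where \<phi>: "\<phi> \<in> formulas L (1 + length e)"
    and D: "D = {a \<in> univ M. sat M ([a] @ e) \<phi>}"
    using assms(1) by (auto simp: definable_set_def)
  have "definable_pred L M e 1 (\<lambda>xs. xs ! 0 \<in> D)"
    unfolding definable_pred_def D using \<phi>
    by (intro bexI[of _ \<phi>]) (auto simp: length_Suc_conv)
  from definable_pred_select[OF this, of "\<lambda>k. i" n] assms(2) show ?thesis
    by simp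
qed

text \<open>\<open>definable_pred\<close> says nothing about lists outside the universe, so
  \<open>R\<close> has to be confined to it for the two notions to agree.\<close>

lemma definable_rel_iff_pred:
  assumes "R \<subseteq> univ M \<times> univ M"
  shows "definable_rel L M e R \<longleftrightarrow> definable_pred L M e 2 (\<lambda>xs. (xs ! 0, xs ! 1) \<in> R)"
proof
  assume "definable_pred L M e 2 (\<lambda>xs. (xs ! 0, xs ! 1) \<in> R)"
  then obtain \<phi> where \<phi>: "\<phi> \<in> formulas L (2 + length e)"
    "\<forall>xs. length xs = 2 \<and> set xs \<subseteq> univ M \<longrightarrow> (sat M (xs @ e) \<phi> \<longleftrightarrow> (xs ! 0, xs ! 1) \<in> R)"
    by (auto simp: definable_pred_def)
  have "(a, b) \<in> R \<longleftrightarrow> sat M ([a, b] @ e) \<phi>" if "a \<in> univ M" "b \<in> univ M" for a b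
    using \<phi>(2)[rule_format, of "[a, b]"] that by simp
  then have "R = {(a, b). a \<in> univ M \<and> b \<in> univ M \<and> sat M ([a, b] @ e) \<phi>}"
    using assms by blast
  with \<phi>(1) show "definable_rel L M e R"
    by (auto simp: definable_rel_def)
qed (simp add: definable_pred_rel)

lemma definable_rel_subset: "definable_rel L M e R \<Longrightarrow> R \<subseteq> univ M \<times> univ M"
  by (auto simp: definable_rel_def)

lemma definable_rel_Un:
  assumes "definable_rel L M e R" "definable_rel L M e S"
  shows "definable_rel L M e (R \<union> S)"
  using assms definable_rel_subset[OF assms(1)] definable_rel_subset[OF assms(2)]
  by (subst definable_rel_iff_pred) (auto intro!: definable_pred_disj definable_pred_rel)

lemma definable_rel_relcomp:
  assumes "definable_rel L M e R" "definable_rel L M e S"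
  shows "definable_rel L M e (R O S)"
proof (subst definable_rel_iff_pred)
  show "R O S \<subseteq> univ M \<times> univ M"
    using definable_rel_subset[OF assms(1)] definable_rel_subset[OF assms(2)] by blast
  \<comment> \<open>Index 0 is the intermediate point to be quantified; the endpoints move to 1 and
    2.\<close>
  have "definable_pred L M e (Suc 2) (\<lambda>xs. (xs ! 1, xs ! 0) \<in> R \<and> (xs ! 0, xs ! 2) \<in> S)"
    by (intro definable_pred_conj definable_pred_rel assms) auto
  from definable_pred_ex[OF this]
  have "definable_pred L M e 2 (\<lambda>xs. \<exists>a\<in>univ M. (xs ! 0, a) \<in> R \<and> (a, xs ! 1) \<in> S)"
    by simp
  moreover have "(x, y) \<in> R O S \<longleftrightarrow> (\<exists>a\<in>univ M. (x, a) \<in> R \<and> (a, y) \<in> S)" for x y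
    using definable_rel_subset[OF assms(1)] by blast
  ultimately show "definable_pred L M e 2 (\<lambda>xs. (xs ! 0, xs ! 1) \<in> R O S)"
    by simp
qed

section \<open>Compactness derived from saturation\<close>

lemma ex_finite_lower_bound:
  assumes "finite \<A>" "\<A> \<subseteq> \<S>" "\<S> \<noteq> {}"
    and "\<And>A B. A \<in> \<S> \<Longrightarrow> B \<in> \<S> \<Longrightarrow> \<exists>C\<in>\<S>. C \<subseteq> A \<inter> B"
  shows "\<exists>C\<in>\<S>. \<forall>A\<in>\<A>. C \<subseteq> A"
  using assms(1,2)
proof (induction \<A>)
  case empty
  then show ?case using assms(3) by blast
next
  case (insert A \<A>)
  then obtain C where "C \<in> \<S>" "\<forall>A\<in>\<A>. C \<subseteq> A" by auto
  moreover obtain C' where "C' \<in> \<S>" "C' \<subseteq> A \<inter> C"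
    using assms(4)[of A C] insert.prems \<open>C \<in> \<S>\<close> by auto
  ultimately show ?case by blast
qed

text \<open>Saturation for a single finite parameter list: a finite set has cardinality below
  \<open>\<kappa>\<close> because \<open>\<kappa>\<close> is uncountable.\<close>

lemma saturated_finite_params:
  assumes "saturated L \<kappa> M" "natLeq <o \<kappa>" "set as \<subseteq> univ M"
    and "\<Psi> \<subseteq> formulas L (Suc (length as))"
    and "\<And>\<Psi>\<^sub>0. \<Psi>\<^sub>0 \<subseteq> \<Psi> \<Longrightarrow> finite \<Psi>\<^sub>0 \<Longrightarrow> \<exists>c\<in>univ M. \<forall>\<phi>\<in>\<Psi>\<^sub>0. sat M (c # as) \<phi>"
  shows "\<exists>c\<in>univ M. \<forall>\<phi>\<in>\<Psi>. sat M (c # as) \<phi>"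
proof -
  let ?\<Sigma> = "(\<lambda>\<phi>. (\<phi>, as)) ` \<Psi>"
  have "|set as| <o \<kappa>"
    using assms(2) finite_iff_ordLess_natLeq[of "set as"] ordLess_transitive by blast
  moreover have "?\<Sigma> \<subseteq> param_formulas L (set as)"
    using assms(4) by (auto simp: param_formulas_def)
  moreover have "\<exists>c\<in>univ M. \<forall>(\<phi>, as)\<in>\<Sigma>\<^sub>0. sat M (c # as) \<phi>" if fin: "\<Sigma>\<^sub>0 \<subseteq> ?\<Sigma>" "finite \<Sigma>\<^sub>0" for \<Sigma>\<^sub>0
  proof -
    obtain \<Psi>\<^sub>0 where "\<Psi>\<^sub>0 \<subseteq> \<Psi>" "finite \<Psi>\<^sub>0" "\<Sigma>\<^sub>0 = (\<lambda>\<phi>. (\<phi>, as)) ` \<Psi>\<^sub>0"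
      using finite_subset_image[OF fin(2,1)] by blast
    then show ?thesis using assms(5)[of \<Psi>\<^sub>0] by auto
  qed
  ultimately have "\<exists>c\<in>univ M. \<forall>(\<phi>, as)\<in>?\<Sigma>. sat M (c # as) \<phi>"
    using assms(1,3) unfolding saturated_def by metis
  then show ?thesis by auto
qed

text \<open>Saturation only speaks of 1-types, so the pair is realized one coordinate at a time.\<close>

lemma saturated_directed_rels:
  assumes "saturated L \<kappa> M" "natLeq <o \<kappa>" "set e \<subseteq> univ M" "\<S> \<noteq> {}"
    and def: "\<And>R. R \<in> \<S> \<Longrightarrow> definable_rel L M e R"
    and ne: "\<And>R. R \<in> \<S> \<Longrightarrow> R \<noteq> {}"
    and dir: "\<And>R S. R \<in> \<S> \<Longrightarrow> S \<in> \<S> \<Longrightarrow> \<exists>Q\<in>\<S>. Q \<subseteq> R \<inter> S"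
  shows "\<Inter>\<S> \<noteq> {}"
proof -
  have "\<forall>R\<in>\<S>. \<exists>\<phi>. \<phi> \<in> formulas L (2 + length e) \<and>
      (\<forall>a\<in>univ M. \<forall>b\<in>univ M. sat M (a # b # e) \<phi> \<longleftrightarrow> (a, b) \<in> R)"
  proof
    fix R assume "R \<in> \<S>"
    then obtain \<phi> where "\<phi> \<in> formulas L (2 + length e)"
      "R = {(a, b). a \<in> univ M \<and> b \<in> univ M \<and> sat M ([a, b] @ e) \<phi>}"
      using def[of R] unfolding definable_rel_def by blast
    then show "\<exists>\<phi>. \<phi> \<in> formulas L (2 + length e) \<and>
      (\<forall>a\<in>univ M. \<forall>b\<in>univ M. sat M (a # b # e) \<phi> \<longleftrightarrow> (a, b) \<in> R)"
      by (intro exI[of _ \<phi>]) simp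
  qed
  from bchoice[OF this] obtain F where F: "\<And>R. R \<in> \<S> \<Longrightarrow> F R \<in> formulas L (2 + length e)"
    and R_iff: "\<And>R a b. R \<in> \<S> \<Longrightarrow> a \<in> univ M \<Longrightarrow> b \<in> univ M \<Longrightarrow>
      sat M (a # b # e) (F R) \<longleftrightarrow> (a, b) \<in> R"
    by auto
  have sub: "R \<subseteq> univ M \<times> univ M" if "R \<in> \<S>" for R
    using def[OF that] by (rule definable_rel_subset)
  \<comment> \<open>\<open>Exists\<close> binds the first coordinate, so \<open>b\<close> is sought
    in the projection of every \<open>R\<close>. Any finitely many of these conditions hold together
    because a lower bound of the relations in the family is nonempty.\<close>
  have "\<exists>b\<in>univ M. \<forall>\<phi>\<in>(\<lambda>R. Exists (F R)) ` \<S>. sat M (b # e) \<phi>"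
  proof (rule saturated_finite_params[OF assms(1,2,3)])
    show "(\<lambda>R. Exists (F R)) ` \<S> \<subseteq> formulas L (Suc (length e))"
      using F by (auto simp: formulas_def)
    fix \<Psi>\<^sub>0 assume "\<Psi>\<^sub>0 \<subseteq> (\<lambda>R. Exists (F R)) ` \<S>" "finite \<Psi>\<^sub>0"
    then obtain \<A> where \<A>: "\<A> \<subseteq> \<S>" "finite \<A>" "\<Psi>\<^sub>0 = (\<lambda>R. Exists (F R)) ` \<A>"
      by (metis finite_subset_image)
    then obtain C where C: "C \<in> \<S>" "\<forall>R\<in>\<A>. C \<subseteq> R"
      using ex_finite_lower_bound[OF \<A>(2,1) assms(4) dir] by blast
    then obtain a b where "(a, b) \<in> C" using ne[OF C(1)] by auto
    then have "a \<in> univ M" "b \<in> univ M" "\<forall>R\<in>\<A>. (a, b) \<in> R"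
      using C sub[OF C(1)] by auto
    then have "\<forall>\<phi>\<in>\<Psi>\<^sub>0. sat M (b # e) \<phi>"
      using \<A> R_iff by fastforce
    then show "\<exists>b\<in>univ M. \<forall>\<phi>\<in>\<Psi>\<^sub>0. sat M (b # e) \<phi>"
      using \<open>b \<in> univ M\<close> by blast
  qed
  then obtain b where b: "b \<in> univ M" "\<And>R. R \<in> \<S> \<Longrightarrow> \<exists>a\<in>univ M. (a, b) \<in> R"
    using R_iff by fastforce
  \<comment> \<open>Now \<open>b\<close> is a parameter. It lies in the projection of every lower
    bound \<open>C\<close>, so a single \<open>a\<close> serves finitely many relations.\<close>
  have "\<exists>a\<in>univ M. \<forall>\<phi>\<in>F ` \<S>. sat M (a # b # e) \<phi>"
  proof (rule saturated_finite_params[OF assms(1,2)])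
    show "set (b # e) \<subseteq> univ M" using b assms(3) by simp
    show "F ` \<S> \<subseteq> formulas L (Suc (length (b # e)))"
      using F by auto
    fix \<Psi>\<^sub>0 assume "\<Psi>\<^sub>0 \<subseteq> F ` \<S>" "finite \<Psi>\<^sub>0"
    then obtain \<A> where \<A>: "\<A> \<subseteq> \<S>" "finite \<A>" "\<Psi>\<^sub>0 = F ` \<A>"
      by (metis finite_subset_image)
    then obtain C where C: "C \<in> \<S>" "\<forall>R\<in>\<A>. C \<subseteq> R"
      using ex_finite_lower_bound[OF \<A>(2,1) assms(4) dir] by blast
    then obtain a where "a \<in> univ M" "(a, b) \<in> C" using b(2) by blast
    then show "\<exists>a\<in>univ M. \<forall>\<phi>\<in>\<Psi>\<^sub>0. sat M (a # b # e) \<phi>"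
      using C \<A> R_iff b(1) by blast
  qed
  then obtain a where "a \<in> univ M" "\<forall>R\<in>\<S>. (a, b) \<in> R"
    using R_iff b(1) by auto
  then show ?thesis by blast
qed

section \<open>Semi-isolation through parameter-free relations preserving the type\<close>

lemma tp_realization:
  assumes "p \<in> complete_1types L M" "a \<in> realizations M p"
  shows "tp L M a = p"
proof
  show "p \<subseteq> tp L M a"
    using assms by (auto simp: complete_1types_def realizations_def tp_def)
  show "tp L M a \<subseteq> p"
  proof
    fix \<phi> assume \<phi>: "\<phi> \<in> tp L M a"
    then have "\<phi> \<in> p \<or> Neg \<phi> \<in> p"
      using assms(1) by (simp add: complete_1types_def tp_def)
    moreover have "\<not> sat M [a] (Neg \<phi>)"
      using \<phi> by (simp add: tp_def)
    ultimately show "\<phi> \<in> p"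
      using assms(2) unfolding realizations_def by blast
  qed
qed

text \<open>The uniform counterpart of a formula witnessing semi-isolation: it works from every
  realization of \<open>p\<close>, not only from one given point.\<close>

definition type_closed_rel ::
    "('f, 'r) language \<Rightarrow> ('f, 'r, 'm) struct \<Rightarrow> ('f, 'r) form set \<Rightarrow> ('m \<times> 'm) set \<Rightarrow> bool" where
  "type_closed_rel L M p S \<longleftrightarrow> definable_rel L M [] S \<and> S `` realizations M p \<subseteq> realizations M p"

text \<open>A witness at \<open>a\<close> is automatically uniform: for \<open>\<psi>\<close> in
  \<open>p\<close>, the statement that every \<open>y\<close> related to \<open>x\<close> satisfies
  \<open>\<psi>\<close> is a parameter-free formula in \<open>x\<close>. If it holds at
  \<open>a\<close>, it belongs to \<open>p\<close> and so holds at all realizations.\<close>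

lemma semi_isolates_iff_type_closed_rel:
  assumes p: "p \<in> complete_1types L M" and a: "a \<in> realizations M p" and b: "b \<in> realizations M p"
  shows "semi_isolates L M a b \<longleftrightarrow> (\<exists>S. type_closed_rel L M p S \<and> (a, b) \<in> S)"
proof
  have univ: "a \<in> univ M" "b \<in> univ M"
    using a b by (auto simp: realizations_def)
  assume "semi_isolates L M a b"
  then obtain \<phi> where \<phi>: "\<phi> \<in> formulas L 2" "sat M [a, b] \<phi>"
    "\<And>\<psi> c. \<psi> \<in> p \<Longrightarrow> c \<in> univ M \<Longrightarrow> sat M [a, c] \<phi> \<Longrightarrow> sat M [c] \<psi>"
    unfolding semi_isolates_def tp_realization[OF p b] by blast
  define S where "S = {(c, d). c \<in> univ M \<and> d \<in> univ M \<and> sat M [c, d] \<phi>}"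
  have S: "definable_rel L M [] S"
    using \<phi>(1) by (auto simp: definable_rel_def S_def)
  have "d \<in> realizations M p" if c: "c \<in> realizations M p" and "(c, d) \<in> S" for c d
    unfolding realizations_def
  proof (intro CollectI conjI ballI)
    have "c \<in> univ M" "d \<in> univ M" using that by (auto simp: S_def)
    then show "d \<in> univ M" by simp
    fix \<psi> assume \<psi>: "\<psi> \<in> p"
    then have "\<psi> \<in> formulas L 1" using p by (auto simp: complete_1types_def)
    then have "definable_pred L M [] (Suc 1) (\<lambda>xs. sat M [xs ! 0] \<psi>)"
      using definable_pred_formula[of \<psi> L 1 "\<lambda>_. 0" "Suc 1" M "[]"] by simp
    \<comment> \<open>Index 0 is the \<open>y\<close> about to be quantified universally, index 1
      the remaining variable \<open>x\<close>.\<close>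
    then have "definable_pred L M [] (Suc 1) (\<lambda>xs. (xs ! 1, xs ! 0) \<in> S \<longrightarrow> sat M [xs ! 0] \<psi>)"
      by (intro definable_pred_imp definable_pred_rel[OF S]) auto
    from definable_pred_all[OF this] obtain \<theta> where \<theta>: "\<theta> \<in> formulas L 1"
      "\<And>xs. length xs = 1 \<Longrightarrow> set xs \<subseteq> univ M \<Longrightarrow>
        sat M xs \<theta> \<longleftrightarrow> (\<forall>y\<in>univ M. (xs ! 0, y) \<in> S \<longrightarrow> sat M [y] \<psi>)"
      by (auto simp: definable_pred_def)
    have "sat M [a] \<theta>"
      using \<theta>(2)[of "[a]"] univ \<phi>(3)[OF \<psi>] by (auto simp: S_def)
    then have "\<theta> \<in> p"
      using \<theta>(1) tp_realization[OF p a] by (auto simp: tp_def)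
    then have "sat M [c] \<theta>"
      using c by (auto simp: realizations_def)
    then show "sat M [d] \<psi>"
      using \<theta>(2)[of "[c]"] \<open>c \<in> univ M\<close> \<open>d \<in> univ M\<close> \<open>(c, d) \<in> S\<close> by auto
  qed
  then have "type_closed_rel L M p S"
    using S by (auto simp: type_closed_rel_def)
  moreover have "(a, b) \<in> S"
    using univ \<phi>(2) by (simp add: S_def)
  ultimately show "\<exists>S. type_closed_rel L M p S \<and> (a, b) \<in> S" by blast
next
  assume "\<exists>S. type_closed_rel L M p S \<and> (a, b) \<in> S"
  then obtain S \<phi> where \<phi>: "\<phi> \<in> formulas L 2"
    and S: "S = {(c, d). c \<in> univ M \<and> d \<in> univ M \<and> sat M [c, d] \<phi>}"
    and cl: "S `` realizations M p \<subseteq> realizations M p" and ab: "(a, b) \<in> S"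
    by (auto simp: type_closed_rel_def definable_rel_def)
  have "sat M [c] \<psi>" if "\<psi> \<in> tp L M b" "c \<in> univ M" "sat M [a, c] \<phi>" for \<psi> c
  proof -
    have "(a, c) \<in> S" using that ab by (auto simp: S)
    then have "c \<in> realizations M p" using cl a by blast
    then show ?thesis using that(1) tp_realization[OF p b] by (auto simp: realizations_def)
  qed
  then show "semi_isolates L M a b"
    using \<phi> ab unfolding semi_isolates_def S by blast
qed

lemma type_closed_rel_Un:
  "type_closed_rel L M p R \<Longrightarrow> type_closed_rel L M p S \<Longrightarrow> type_closed_rel L M p (R \<union> S)"
  unfolding type_closed_rel_def using definable_rel_Un by blast

lemma type_closed_rel_relcomp:
  "type_closed_rel L M p R \<Longrightarrow> type_closed_rel L M p S \<Longrightarrow> type_closed_rel L M p (R O S)"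
  unfolding type_closed_rel_def using definable_rel_relcomp by blast

text \<open>Composing the two witnessing relations again preserves \<open>p(M)\<close>.\<close>

lemma semi_isolates_trans:
  assumes p: "p \<in> complete_1types L M"
    and abc: "a \<in> realizations M p" "b \<in> realizations M p" "c \<in> realizations M p"
    and "semi_isolates L M a b" "semi_isolates L M b c"
  shows "semi_isolates L M a c"
proof -
  obtain R S where "type_closed_rel L M p R" "(a, b) \<in> R" "type_closed_rel L M p S" "(b, c) \<in> S"
    using assms semi_isolates_iff_type_closed_rel[OF p] by metis
  then show ?thesis
    using type_closed_rel_relcomp semi_isolates_iff_type_closed_rel[OF p abc(1,3)] by blast
qed

section \<open>One relation covering all semi-isolated pairs\<close>

text \<open>If every \<open>S\<close> failed, the sets \<open>U S\<close> of uncovered pairs would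
  be nonempty. They are \<open>e\<close>-definable because \<open>E\<close> replaces
  \<open>SI_bar\<close>, and directed because unions of type-closed relations are type-closed. A
  common point would be a pair in \<open>SI_bar\<close> with semi-isolation in neither
  direction.\<close>

lemma SI_bar_uniform_type_closed_rel:
  assumes sat: "saturated L \<kappa> M" "natLeq <o \<kappa>" and p: "p \<in> complete_1types L M"
    and e: "set e \<subseteq> univ M" and D: "definable_set L M e D\<^sub>1" "definable_set L M e D\<^sub>2"
    and ne: "SI_bar L M p \<inter> (D\<^sub>1 \<times> D\<^sub>2) \<noteq> {}"
    and E: "definable_rel L M e E" "SI_bar L M p \<inter> (D\<^sub>1 \<times> D\<^sub>2) = E \<inter> (D\<^sub>1 \<times> D\<^sub>2)"
  shows "\<exists>S. type_closed_rel L M p S \<and> SI_bar L M p \<inter> (D\<^sub>1 \<times> D\<^sub>2) \<subseteq> S \<union> S\<inverse>"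
proof (rule ccontr)
  assume contr: "\<not> ?thesis"
  define U where "U S = SI_bar L M p \<inter> (D\<^sub>1 \<times> D\<^sub>2) - (S \<union> S\<inverse>)" for S
  let ?\<S> = "U ` {S. type_closed_rel L M p S}"
  have semi: "\<exists>S. type_closed_rel L M p S \<and> ((a, b) \<in> S \<or> (b, a) \<in> S)"
    if "(a, b) \<in> SI_bar L M p" for a b
    using that semi_isolates_iff_type_closed_rel[OF p] unfolding SI_bar_def by blast
  have "\<Inter>?\<S> \<noteq> {}"
  proof (rule saturated_directed_rels[OF sat e])
    show "?\<S> \<noteq> {}"
      using ne semi by blast
    show "R \<noteq> {}" if "R \<in> ?\<S>" for R
      using that contr by (auto simp: U_def)
    show "definable_rel L M e R" if R: "R \<in> ?\<S>" for R
    proof -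
      obtain S where S: "definable_rel L M [] S" "R = U S"
        using R by (auto simp: type_closed_rel_def)
      have "R \<subseteq> univ M \<times> univ M"
        using definable_rel_subset[OF E(1)] unfolding S(2) U_def E(2) by blast
      moreover have "definable_pred L M e 2 (\<lambda>xs. ((xs ! 0, xs ! 1) \<in> E \<and> xs ! 0 \<in> D\<^sub>1 \<and> xs ! 1 \<in> D\<^sub>2) \<and>
          \<not> ((xs ! 0, xs ! 1) \<in> S \<or> (xs ! 1, xs ! 0) \<in> S))"
        by (intro definable_pred_conj definable_pred_not definable_pred_disj definable_pred_rel
            definable_pred_rel_empty_params definable_pred_set E(1) D S(1)) auto
      ultimately show ?thesis
        unfolding S(2) U_def E(2) by (subst definable_rel_iff_pred) auto
    qed
    show "\<exists>Q\<in>?\<S>. Q \<subseteq> R \<inter> R'" if "R \<in> ?\<S>" "R' \<in> ?\<S>" for R R'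
    proof -
      obtain S S' where S: "type_closed_rel L M p S" "type_closed_rel L M p S'" "R = U S" "R' = U S'"
        using \<open>R \<in> ?\<S>\<close> \<open>R' \<in> ?\<S>\<close> by auto
      have "U (S \<union> S') \<subseteq> R \<inter> R'"
        unfolding S U_def by blast
      then show ?thesis
        using type_closed_rel_Un[OF S(1,2)] by blast
    qed
  qed
  then obtain a b where ab: "\<And>S. type_closed_rel L M p S \<Longrightarrow> (a, b) \<in> U S"
    by auto
  \<comment> \<open>This needs at least one type-closed relation; a pair given by \<open>ne\<close>
    provides it through \<open>semi\<close>.\<close>
  with ne semi have "(a, b) \<in> SI_bar L M p"
    by (fastforce simp: U_def)
  then show False
    using semi ab by (fastforce simp: U_def)
qed

section \<open>Comparing fibres: the definable order and the strict order property\<close>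

text \<open>Inclusion and emptiness of fibres are first-order conditions, since \<open>G\<close>
  lies in the square of the universe and a quantifier over \<open>univ M\<close> sees whole
  fibres.\<close>

lemma definable_rel_image_order:
  assumes "definable_rel L M e G"
  shows "definable_rel L M e {(x, y). x \<in> univ M \<and> y \<in> univ M \<and>
    G `` {y} \<subseteq> G `` {x} \<and> (G `` {y} = {} \<longrightarrow> G `` {x} = {})}"
proof (subst definable_rel_iff_pred)
  have sub: "G \<subseteq> univ M \<times> univ M"
    using assms by (rule definable_rel_subset)
  have "definable_pred L M e (Suc 2) (\<lambda>xs. (xs ! 2, xs ! 0) \<in> G \<longrightarrow> (xs ! 1, xs ! 0) \<in> G)"
    by (intro definable_pred_imp definable_pred_rel assms) auto
  from definable_pred_all[OF this]
  have 1: "definable_pred L M e 2 (\<lambda>xs. \<forall>z\<in>univ M. (xs ! 1, z) \<in> G \<longrightarrow> (xs ! 0, z) \<in> G)"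
    by simp
  have 2: "definable_pred L M e 2 (\<lambda>xs. \<forall>z\<in>univ M. (xs ! i, z) \<notin> G)" if "i < 2" for i
  proof -
    have "definable_pred L M e (Suc 2) (\<lambda>xs. (xs ! Suc i, xs ! 0) \<notin> G)"
      using that by (intro definable_pred_not definable_pred_rel assms) auto
    from definable_pred_all[OF this] show ?thesis by simp
  qed
  have "definable_pred L M e 2 (\<lambda>xs. (\<forall>z\<in>univ M. (xs ! 1, z) \<in> G \<longrightarrow> (xs ! 0, z) \<in> G) \<and>
      ((\<forall>z\<in>univ M. (xs ! 1, z) \<notin> G) \<longrightarrow> (\<forall>z\<in>univ M. (xs ! 0, z) \<notin> G)))"
    by (intro definable_pred_conj definable_pred_imp 1 2) auto
  moreover have "(\<forall>z\<in>univ M. (x, z) \<notin> G) \<longleftrightarrow> G `` {x} = {}"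
    "(\<forall>z\<in>univ M. (y, z) \<in> G \<longrightarrow> (x, z) \<in> G) \<longleftrightarrow> G `` {y} \<subseteq> G `` {x}" for x y
    using sub by blast+
  ultimately have "definable_pred L M e 2 (\<lambda>xs. G `` {xs ! 1} \<subseteq> G `` {xs ! 0} \<and>
      (G `` {xs ! 1} = {} \<longrightarrow> G `` {xs ! 0} = {}))"
    by simp
  then show "definable_pred L M e 2 (\<lambda>xs. (xs ! 0, xs ! 1) \<in> {(x, y). x \<in> univ M \<and> y \<in> univ M \<and>
    G `` {y} \<subseteq> G `` {x} \<and> (G `` {y} = {} \<longrightarrow> G `` {x} = {})})"
    by (rule definable_pred_cong) (auto elim!: length_2E)
qed auto

text \<open>Complements of the decreasing fibres form the increasing chain, so the formula is the
  negation of \<open>G\<close> with the point of the fibre as object variable.\<close>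

lemma strict_order_property_if_decreasing_images:
  assumes "definable_rel L M e G" "set e \<subseteq> univ M"
    and "\<And>i. a i \<in> univ M" "\<And>i :: nat. G `` {a (Suc i)} \<subset> G `` {a i}"
  shows "strict_order_property L M"
proof -
  have "definable_pred L M e 2 (\<lambda>xs. (xs ! 1, xs ! 0) \<notin> G)"
    by (intro definable_pred_not definable_pred_rel assms) auto
  \<comment> \<open>The \<open>2 + length e\<close> variables are regrouped: one object variable,
    then the parameter tuple \<open>a i # e\<close>. The object variable comes first, which is why
    the arguments of \<open>G\<close> are swapped.\<close>
  then obtain \<phi> where \<phi>: "\<phi> \<in> formulas L (1 + Suc (length e))"
    "\<And>xs. length xs = 2 \<Longrightarrow> set xs \<subseteq> univ M \<Longrightarrow> sat M (xs @ e) \<phi> \<longleftrightarrow> (xs ! 1, xs ! 0) \<notin> G"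
    by (auto simp: definable_pred_def)
  have "sat M (x # a i # e) \<phi> \<longleftrightarrow> (a i, x) \<notin> G" if "x \<in> univ M" for x i
    using \<phi>(2)[of "[x, a i]"] that assms(3) by simp
  then have sol: "solutions M 1 \<phi> (a i # e) = (\<lambda>x. [x]) ` (univ M - G `` {a i})" for i
    by (auto simp: solutions_def length_Suc_conv)
  have "univ M - G `` {a i} \<subset> univ M - G `` {a (Suc i)}" for i
    using assms(4)[of i] definable_rel_subset[OF assms(1)] by blast
  then have "solutions M 1 \<phi> (a i # e) \<subset> solutions M 1 \<phi> (a (Suc i) # e)" for i
    unfolding sol by (auto simp: psubset_eq inj_image_eq_iff inj_def)
  with \<phi>(1) assms(2,3) show ?thesis
    unfolding strict_order_property_def
    by (intro exI[of _ 1] exI[of _ "Suc (length e)"] bexI[of _ \<phi>] exI[of _ "\<lambda>i. a i # e"]) auto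
qed

section \<open>The quasi-order without maximal elements above realizations\<close>

theorem theorem3p1:
  fixes L :: "('f, 'r) language"
    and T :: "('f, 'r) form set"
    and \<kappa> :: "'k rel"
    and M :: "('f, 'r, 'm) struct"
    and p :: "('f, 'r) form set"
    and e :: "'m list"
    and D\<^sub>1 D\<^sub>2 :: "'m set"
  assumes "countable_language L"
    and "complete_theory L T"
    and "monster_model L T \<kappa> M"
    and "p \<in> complete_1types L M"
    and "\<not> isolated M p"
    and "set e \<subseteq> univ M"
    and "definable_set L M e D\<^sub>1"
    and "definable_set L M e D\<^sub>2"
    and "SI_bar L M p \<inter> (D\<^sub>1 \<times> D\<^sub>2) \<noteq> {}"
    and "\<exists>E. definable_rel L M e E \<and> SI_bar L M p \<inter> (D\<^sub>1 \<times> D\<^sub>2) = E \<inter> (D\<^sub>1 \<times> D\<^sub>2)"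
    and "\<forall>a \<in> D\<^sub>1 \<inter> realizations M p. \<exists>b \<in> D\<^sub>2 \<inter> realizations M p. strictly_semi_isolates L M a b"
    and "\<forall>b \<in> D\<^sub>2 \<inter> realizations M p. \<exists>a \<in> D\<^sub>1 \<inter> realizations M p. semi_isolates L M b a"
  shows "(\<exists>R. definable_rel L M e R \<and> preorder_on (univ M) R \<and>
            \<not> (\<exists>a \<in> D\<^sub>1 \<inter> realizations M p. \<exists>c \<in> D\<^sub>1. (a, c) \<in> R \<and> maximal_in R D\<^sub>1 c))
         \<and> strict_order_property L M"
proof -
  let ?p = "realizations M p"
  have sat: "saturated L \<kappa> M" "natLeq <o \<kappa>"
    using assms(3) by (auto simp: monster_model_def)
  note p = assms(4) and e = assms(6) and D = assms(7,8)
  note trans = semi_isolates_trans[OF p]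
  obtain E where E: "definable_rel L M e E" "SI_bar L M p \<inter> (D\<^sub>1 \<times> D\<^sub>2) = E \<inter> (D\<^sub>1 \<times> D\<^sub>2)"
    using assms(10) by blast
  obtain S where S: "type_closed_rel L M p S" "SI_bar L M p \<inter> (D\<^sub>1 \<times> D\<^sub>2) \<subseteq> S \<union> S\<inverse>"
    using SI_bar_uniform_type_closed_rel[OF sat p e D assms(9) E] by blast
  define G where "G = E \<inter> (D\<^sub>1 \<times> D\<^sub>2) \<inter> S"
  have G_definable: "definable_rel L M e G"
  proof (subst definable_rel_iff_pred)
    show "G \<subseteq> univ M \<times> univ M"
      using definable_rel_subset[OF E(1)] by (auto simp: G_def)
    have "definable_pred L M e 2 (\<lambda>xs. ((xs ! 0, xs ! 1) \<in> E \<and> xs ! 0 \<in> D\<^sub>1 \<and> xs ! 1 \<in> D\<^sub>2) \<and>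
        (xs ! 0, xs ! 1) \<in> S)"
      using S(1) by (intro definable_pred_conj definable_pred_rel definable_pred_rel_empty_params
          definable_pred_set E(1) D) (auto simp: type_closed_rel_def)
    then show "definable_pred L M e 2 (\<lambda>xs. (xs ! 0, xs ! 1) \<in> G)"
      by (simp add: G_def)
  qed
  \<comment> \<open>Membership in \<open>E\<close> within
    \<open>D\<^sub>1 \<times> D\<^sub>2\<close> puts both points in \<open>p(M)\<close>; membership
    in \<open>S\<close> then fixes the direction.\<close>
  have G_semi: "a \<in> D\<^sub>1 \<inter> ?p \<and> b \<in> D\<^sub>2 \<inter> ?p \<and> semi_isolates L M a b" if "(a, b) \<in> G" for a b
  proof -
    have "(a, b) \<in> SI_bar L M p" "a \<in> D\<^sub>1" "b \<in> D\<^sub>2" "(a, b) \<in> S"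
      using that E(2) by (auto simp: G_def)
    then show ?thesis
      using semi_isolates_iff_type_closed_rel[OF p] S(1) by (auto simp: SI_bar_def)
  qed
  have strict_G: "(a, b) \<in> G"
    if "a \<in> D\<^sub>1 \<inter> ?p" "b \<in> D\<^sub>2 \<inter> ?p" "strictly_semi_isolates L M a b" for a b
  proof -
    have SI: "(a, b) \<in> SI_bar L M p \<inter> (D\<^sub>1 \<times> D\<^sub>2)"
      using that by (auto simp: SI_bar_def strictly_semi_isolates_def)
    \<comment> \<open>Strictness excludes the converse half of the cover
      \<open>S \<union> S\<inverse>\<close>, leaving \<open>(a, b) \<in> S\<close>.\<close>
    moreover have "(b, a) \<notin> S"
      using that S(1) semi_isolates_iff_type_closed_rel[OF p, of b a]
      by (auto simp: strictly_semi_isolates_def)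
    ultimately show ?thesis
      using S(2) E(2) by (auto simp: G_def)
  qed
  have G_antimono: "G `` {a'} \<subseteq> G `` {a}"
    if a: "a \<in> D\<^sub>1 \<inter> ?p" "a' \<in> D\<^sub>1 \<inter> ?p" "strictly_semi_isolates L M a a'" for a a'
  proof
    fix b assume "b \<in> G `` {a'}"
    then have b: "b \<in> D\<^sub>2 \<inter> ?p" "semi_isolates L M a' b"
      using G_semi by auto
    \<comment> \<open>If \<open>b \<rightarrow> a\<close>, then
      \<open>a' \<rightarrow> b \<rightarrow> a\<close>, contrary to
      \<open>a \<mapsto> a'\<close>.\<close>
    then have "strictly_semi_isolates L M a b"
      using a trans[of a a' b] trans[of a' b a] by (auto simp: strictly_semi_isolates_def)
    then show "b \<in> G `` {a}"
      using strict_G a b by blast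
  qed
  have step: "\<exists>b a'. b \<in> D\<^sub>2 \<inter> ?p \<and> a' \<in> D\<^sub>1 \<inter> ?p \<and> (a, b) \<in> G \<and> semi_isolates L M b a' \<and>
      strictly_semi_isolates L M a a'" if a: "a \<in> D\<^sub>1 \<inter> ?p" for a
  proof -
    obtain b where b: "b \<in> D\<^sub>2 \<inter> ?p" "strictly_semi_isolates L M a b"
      using assms(11) a by blast
    obtain a' where a': "a' \<in> D\<^sub>1 \<inter> ?p" "semi_isolates L M b a'"
      using assms(12) b(1) by blast
    \<comment> \<open>If \<open>a' \<rightarrow> a\<close>, then
      \<open>b \<rightarrow> a' \<rightarrow> a\<close>, contrary to
      \<open>a \<mapsto> b\<close>.\<close>
    have "strictly_semi_isolates L M a a'"
      using a b a' trans[of a b a'] trans[of b a' a] by (auto simp: strictly_semi_isolates_def)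
    then show ?thesis
      using a b a' strict_G by blast
  qed
  have G_psubset: "\<exists>a''. a'' \<in> D\<^sub>1 \<inter> ?p \<and> G `` {a''} \<subset> G `` {a}" if a: "a \<in> D\<^sub>1 \<inter> ?p" for a
  proof -
    obtain b a' where b: "b \<in> D\<^sub>2 \<inter> ?p" and a': "a' \<in> D\<^sub>1 \<inter> ?p" "(a, b) \<in> G"
      "semi_isolates L M b a'" "strictly_semi_isolates L M a a'"
      using step[OF a] by blast
    obtain a'' where a'': "a'' \<in> D\<^sub>1 \<inter> ?p" "strictly_semi_isolates L M a' a''"
      using step[OF a'(1)] by blast
    \<comment> \<open>Otherwise \<open>a'' \<rightarrow> b \<rightarrow> a'\<close>, contrary to
      \<open>a' \<mapsto> a''\<close>. A second alternation is taken because
      \<open>b \<rightarrow> a'\<close> need not be strict, so this argument does not exclude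
      \<open>(a', b) \<in> G\<close>.\<close>
    have "(a'', b) \<notin> G"
      using G_semi[of a'' b] trans[of a'' b a'] a' a'' by (auto simp: strictly_semi_isolates_def)
    moreover have "G `` {a''} \<subseteq> G `` {a}"
      using G_antimono[OF a a'(1,4)] G_antimono[OF a'(1) a''] by blast
    ultimately show ?thesis
      using a'(2) a''(1) by blast
  qed
  have G_nonempty: "G `` {a} \<noteq> {}" if "a \<in> D\<^sub>1 \<inter> ?p" for a
    using step[OF that] by blast

  \<comment> \<open>The emptiness clause keeps elements of \<open>D\<^sub>1\<close> outside \<open>p(M)\<close>, where \<open>G\<close> is empty, from lying
    above elements of \<open>D\<^sub>1 \<inter> p(M)\<close>.\<close>
  define R where "R = {(x, y). x \<in> univ M \<and> y \<in> univ M \<and>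
    G `` {y} \<subseteq> G `` {x} \<and> (G `` {y} = {} \<longrightarrow> G `` {x} = {})}"
  have "preorder_on (univ M) R"
    unfolding preorder_on_def R_def by (auto intro!: refl_onI transI)
  moreover have "\<not> maximal_in R D\<^sub>1 c" if a: "a \<in> D\<^sub>1 \<inter> ?p" and "(a, c) \<in> R" for a c
  proof -
    \<comment> \<open>An empty fibre at \<open>c\<close> would force an empty one at
      \<open>a\<close>. Nonemptiness in turn places \<open>c\<close> in \<open>p(M)\<close>, where
      fibres can be shrunk further.\<close>
    have "G `` {c} \<noteq> {}"
      using G_nonempty[OF a] that(2) by (auto simp: R_def)
    then have c: "c \<in> D\<^sub>1 \<inter> ?p"
      using G_semi by blast
    obtain d where d: "d \<in> D\<^sub>1 \<inter> ?p" "G `` {d} \<subset> G `` {c}"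
      using G_psubset[OF c] by blast
    then have "(c, d) \<in> R" "(d, c) \<notin> R"
      using c G_nonempty[OF d(1)] by (auto simp: R_def realizations_def)
    then show ?thesis
      using d(1) by (auto simp: maximal_in_def)
  qed
  moreover have "definable_rel L M e R"
    unfolding R_def by (rule definable_rel_image_order[OF G_definable])
  moreover have "strict_order_property L M"
  proof -
    \<comment> \<open>The nonempty intersection of \<open>SI_bar\<close> with
      \<open>D\<^sub>1 \<times> D\<^sub>2\<close> supplies the start of the chain; dependent choice
      then iterates \<open>G_psubset\<close>.\<close>
    obtain a\<^sub>0 where "a\<^sub>0 \<in> D\<^sub>1 \<inter> ?p"
      using assms(9) by (auto simp: SI_bar_def)
    then obtain a where "\<And>i :: nat. a i \<in> D\<^sub>1 \<inter> ?p \<and> G `` {a (Suc i)} \<subset> G `` {a i}"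
      using dependent_nat_choice[of "\<lambda>_ x. x \<in> D\<^sub>1 \<inter> ?p" "\<lambda>_ x y. G `` {y} \<subset> G `` {x}"] G_psubset
      by metis
    then show ?thesis
      using strict_order_property_if_decreasing_images[OF G_definable e, of a] by (auto simp: realizations_def)
  qed
  ultimately show ?thesis by blast
qed

end
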